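(* $$\delta_{2,2}(G_{\infty})=\frac{1}{3}.$$
   Context: $G_\infty$ denotes the infinite grid: the graph with vertex set $\mathbb{Z}\times\mathbb{Z}$ in which two vertices are adjacent if and only if they are at Euclidean distance $1$. $dist(\cdot,\cdot)$ is the graph distance (so $dist((a,b),(c,d))=|a-c|+|b-d|$). Let $t,r$ be positive integers. For a set of vertices $\mathbb{T}\subseteq \mathbb{Z}\times\mathbb{Z}$ (whose elements are called towers, of signal strength $t$), the signal a vertex $v$ receives from a tower $T\in\mathbb{T}$ is $sig(v,T)=\min(\max(t-dist(v,T),0),r)$, and the total signal at $v$ is $sig(v)=\sum_{T\in\mathbb{T}} sig(v,T)$. The set $\mathbb{T}$ is a $(t,r)$ broadcast on $G_\infty$ if $sig(v)\geq r$ for every vertex $v$. (Omitting the truncation at $r$ in the definition of signal gives the same notion of broadcast.) The broadcast density of $\mathbb{T}$ is $\lim_{n\to\infty} \frac{|\mathbb{T}\cap V_n|}{|V_n|}$, where $V_n=\{-n,\dots,n\}\times\{-n,\dots,n\}$. The optimal density $\delta_{t,r}(G_\infty)$ is the minimum broadcast density over all $(t,r)$ broadcasts on $G_\infty$ (among those for which the limit exists). *)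

theory Defs
  imports "HOL-Analysis.Analysis"
begin

type_synonym vertex = "int \<times> int"

text \<open>On \<^typ>\<open>real \<times> real\<close> the library's \<^const>\<open>dist\<close> is the Euclidean distance.\<close>

definition grid_edges :: "(vertex \<times> vertex) set" where
  "grid_edges = {((a, b), (c, d)) | a b c d.
     dist (real_of_int a, real_of_int b) (real_of_int c, real_of_int d) = 1}"

text \<open>The least length of a walk; the grid is connected, so such a walk always exists.\<close>

definition grid_dist :: "vertex \<Rightarrow> vertex \<Rightarrow> nat" where
  "grid_dist u v = (LEAST k. (u, v) \<in> grid_edges ^^ k)"

definition tower_signal :: "nat \<Rightarrow> nat \<Rightarrow> vertex \<Rightarrow> vertex \<Rightarrow> real" where
  "tower_signal t r v T = min (max (real t - real (grid_dist v T)) 0) (real r)"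

text \<open>The set of towers may be infinite, so \<^const>\<open>sum\<close> would not do. Only the finitely many
  towers at distance less than \<open>t\<close> from \<open>v\<close> contribute, so the sum always converges.\<close>

definition signal :: "nat \<Rightarrow> nat \<Rightarrow> vertex set \<Rightarrow> vertex \<Rightarrow> real" where
  "signal t r \<T> v = (\<Sum>\<^sub>\<infinity>T\<in>\<T>. tower_signal t r v T)"

definition broadcast :: "nat \<Rightarrow> nat \<Rightarrow> vertex set \<Rightarrow> bool" where
  "broadcast t r \<T> \<longleftrightarrow> (\<forall>v. signal t r \<T> v \<ge> real r)"

definition grid_box :: "nat \<Rightarrow> vertex set" where
  "grid_box n = {- int n..int n} \<times> {- int n..int n}"

definition has_broadcast_density :: "vertex set \<Rightarrow> real \<Rightarrow> bool" where
  "has_broadcast_density \<T> d \<longleftrightarrow>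
     (\<lambda>n. real (card (\<T> \<inter> grid_box n)) / real (card (grid_box n))) \<longlonglongrightarrow> d"

text \<open>A relation rather than a function of \<open>t\<close> and \<open>r\<close>, because it includes the claim that the
  minimum is attained. At most one \<open>d\<close> satisfies it. Broadcasts without a density play no role.\<close>

definition is_optimal_density :: "nat \<Rightarrow> nat \<Rightarrow> real \<Rightarrow> bool" where
  "is_optimal_density t r d \<longleftrightarrow>
     (\<exists>\<T>. broadcast t r \<T> \<and> has_broadcast_density \<T> d) \<and>
     (\<forall>\<T> d'. broadcast t r \<T> \<and> has_broadcast_density \<T> d' \<longrightarrow> d \<le> d')"

end

theory Submission
  imports Defs "HOL-Real_Asymp.Real_Asymp"
begin

text \<open>
  A tower of strength 2 gives signal 2 to its own vertex, 1 to each of its four neighbours, and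
  0 elsewhere, so it emits 6 in total. A broadcast gives every vertex at least 2; double counting
  the signal received in the box of radius \<open>n\<close>, all of which comes from towers in the box of
  radius \<open>n + 1\<close>, shows that the larger box contains at least a third as many towers as the
  smaller one has vertices (\<open>card_broadcast_box_ge\<close>). Since consecutive boxes have asymptotically
  the same size, no density is below \<open>1/3\<close>.

  The bound is attained by a residue class of \<open>a + b\<close> modulo 3 (\<open>broadcast_diagonals\<close>): a vertex
  outside the class has exactly two of its neighbours in it. That this set has density exactly
  \<open>1/3\<close> needs no further counting. All three residue classes are broadcasts, so each obeys the
  lower bound; as they partition the box, the lower bounds for two of them give an upper bound
  for the third.
\<close>

lemma grid_edges_iff: "((a, b), (c, d)) \<in> grid_edges \<longleftrightarrow> \<bar>a - c\<bar> + \<bar>b - d\<bar> = 1"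
proof -
  have "dist (real_of_int a, real_of_int b) (real_of_int c, real_of_int d) = 1 \<longleftrightarrow>
      (real_of_int (a - c))\<^sup>2 + (real_of_int (b - d))\<^sup>2 = 1"
    by (simp add: dist_Pair_Pair dist_real_def)
  also have "\<dots> \<longleftrightarrow> real_of_int ((a - c)\<^sup>2 + (b - d)\<^sup>2) = real_of_int 1"
    by simp
  also have "\<dots> \<longleftrightarrow> (a - c)\<^sup>2 + (b - d)\<^sup>2 = 1"
    by (simp only: of_int_eq_iff)
  also have "\<dots> \<longleftrightarrow> \<bar>a - c\<bar> + \<bar>b - d\<bar> = 1"
  proof
    assume sq: "(a - c)\<^sup>2 + (b - d)\<^sup>2 = 1"
    have abs_le: "\<bar>x\<bar> \<le> x\<^sup>2" for x :: int
      using self_le_power[of "\<bar>x\<bar>" 2] by (cases "x = 0") auto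
    have "\<bar>a - c\<bar> + \<bar>b - d\<bar> \<le> 1"
      using abs_le[of "a - c"] abs_le[of "b - d"] sq by linarith
    moreover have "a \<noteq> c \<or> b \<noteq> d"
      using sq by auto
    ultimately show "\<bar>a - c\<bar> + \<bar>b - d\<bar> = 1"
      by linarith
  next
    assume "\<bar>a - c\<bar> + \<bar>b - d\<bar> = 1"
    then have "(a - c = 0 \<and> \<bar>b - d\<bar> = 1) \<or> (\<bar>a - c\<bar> = 1 \<and> b - d = 0)"
      by linarith
    then show "(a - c)\<^sup>2 + (b - d)\<^sup>2 = 1"
      by (metis add.commute add.right_neutral one_power2 power2_abs zero_power2)
  qed
  finally show ?thesis
    by (auto simp: grid_edges_def)
qed

lemma grid_connected: "(u, v) \<in> grid_edges\<^sup>*"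
proof -
  obtain a b c d where uv: "u = (a, b)" "v = (c, d)"
    by (metis surj_pair)
  have "((a, b), (c, d)) \<in> grid_edges\<^sup>*"
  proof (induction "nat (\<bar>a - c\<bar> + \<bar>b - d\<bar>)" arbitrary: a b)
    case 0
    then have "a = c" "b = d" by linarith+
    then show ?case by simp
  next
    case (Suc n)
    \<comment> \<open>Move one step towards the target, horizontally if the columns differ.\<close>
    define a' where "a' = a + sgn (c - a)"
    define b' where "b' = (if a = c then b + sgn (d - b) else b)"
    have "\<bar>a - a'\<bar> + \<bar>b - b'\<bar> = 1" "n = nat (\<bar>a' - c\<bar> + \<bar>b' - d\<bar>)"
      using Suc.hyps(2) by (auto simp: a'_def b'_def sgn_if split: if_splits)
    then have "((a, b), (a', b')) \<in> grid_edges" "((a', b'), (c, d)) \<in> grid_edges\<^sup>*"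
      using Suc.hyps(1) by (auto simp: grid_edges_iff)
    then show ?case
      by (rule converse_rtrancl_into_rtrancl)
  qed
  then show ?thesis using uv by simp
qed

text \<open>Without connectivity the least length of a walk could be an arbitrary value.\<close>

lemma grid_dist_walk: "(u, v) \<in> grid_edges ^^ grid_dist u v"
  unfolding grid_dist_def using grid_connected[of u v]
  by (auto simp: rtrancl_power intro: LeastI)

lemma grid_dist_eq_0_iff: "grid_dist u v = 0 \<longleftrightarrow> u = v"
proof
  show "u = v" if "grid_dist u v = 0"
    using grid_dist_walk[of u v] that by simp
qed (simp add: grid_dist_def)

lemma grid_dist_eq_1_iff: "grid_dist u v = 1 \<longleftrightarrow> (u, v) \<in> grid_edges"
proof
  show "(u, v) \<in> grid_edges" if "grid_dist u v = 1"
    using grid_dist_walk[of u v] that by simp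
next
  assume edge: "(u, v) \<in> grid_edges"
  then have "(u, v) \<in> grid_edges ^^ 1"
    by simp
  then have "grid_dist u v \<le> 1"
    unfolding grid_dist_def by (rule Least_le)
  moreover have "u \<noteq> v"
    using edge by (cases u; cases v) (auto simp: grid_edges_iff)
  then have "grid_dist u v \<noteq> 0"
    by (simp add: grid_dist_eq_0_iff)
  ultimately show "grid_dist u v = 1"
    by linarith
qed

text \<open>The four unit vectors, that is, the neighbours of the origin.\<close>

definition units :: "vertex set" where
  "units = {(1, 0), (-1, 0), (0, 1), (0, -1)}"

lemma grid_edges_iff_units: "(u, v) \<in> grid_edges \<longleftrightarrow> v - u \<in> units"
  by (cases u; cases v) (auto simp: grid_edges_iff units_def)

lemma tower_signal_2_2:
  "tower_signal 2 2 v T = (if T = v then 2 else if T - v \<in> units then 1 else 0)"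
proof -
  consider "T = v" | "T - v \<in> units" "T \<noteq> v" | "T - v \<notin> units" "T \<noteq> v"
    by blast
  then show ?thesis
  proof cases
    case 1
    then show ?thesis
      using grid_dist_eq_0_iff[of v T] by (simp add: tower_signal_def)
  next
    case 2
    then show ?thesis
      using grid_dist_eq_1_iff[of v T] by (simp add: tower_signal_def grid_edges_iff_units)
  next
    case 3
    then have "grid_dist v T \<noteq> 0" "grid_dist v T \<noteq> 1"
      by (auto simp: grid_dist_eq_0_iff grid_dist_eq_1_iff[unfolded One_nat_def] grid_edges_iff_units)
    then have "grid_dist v T \<ge> 2"
      by linarith
    then show ?thesis
      using 3 by (simp add: tower_signal_def)
  qed
qed

lemma signal_2_2:
  "signal 2 2 \<T> v = 2 * of_bool (v \<in> \<T>) + (\<Sum>e\<in>units. of_bool (v + e \<in> \<T>))"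
proof -
  let ?N = "(+) v ` insert 0 units"
  have fin: "finite units"
    by (simp add: units_def)
  have "0 \<notin> units"
    by (auto simp: units_def zero_prod_def)
  have "signal 2 2 \<T> v = (\<Sum>\<^sub>\<infinity>w\<in>?N. of_bool (w \<in> \<T>) * tower_signal 2 2 v w)"
    unfolding signal_def
  proof (rule infsum_cong_neutral)
    fix w assume "w \<in> \<T> - ?N"
    moreover have "w = v + (w - v)"
      by simp
    ultimately have "w \<noteq> v" "w - v \<notin> units"
      by (auto simp: image_iff)
    then show "tower_signal 2 2 v w = 0"
      by (simp add: tower_signal_2_2)
  qed auto
  also have "\<dots> = (\<Sum>w\<in>?N. of_bool (w \<in> \<T>) * tower_signal 2 2 v w)"
    using fin by (intro infsum_finite) auto
  also have "\<dots> = (\<Sum>e\<in>insert 0 units. of_bool (v + e \<in> \<T>) * tower_signal 2 2 v (v + e))"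
    by (subst sum.reindex) auto
  also have "\<dots> = 2 * of_bool (v \<in> \<T>) +
      (\<Sum>e\<in>units. of_bool (v + e \<in> \<T>) * tower_signal 2 2 v (v + e))"
    using fin \<open>0 \<notin> units\<close> by (simp add: tower_signal_2_2)
  also have "(\<Sum>e\<in>units. of_bool (v + e \<in> \<T>) * tower_signal 2 2 v (v + e)) =
      (\<Sum>e\<in>units. of_bool (v + e \<in> \<T>))"
    using \<open>0 \<notin> units\<close> by (intro sum.cong) (auto simp: tower_signal_2_2)
  finally show ?thesis .
qed

lemma finite_grid_box: "finite (grid_box n)"
  by (simp add: grid_box_def)

lemma card_grid_box: "card (grid_box n) = (2 * n + 1)\<^sup>2"
proof -
  have "card {- int n..int n} = 2 * n + 1"
    by simp
  then show ?thesis
    by (simp only: grid_box_def card_cartesian_product power2_eq_square)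
qed

lemma sum_translate_le_card:
  fixes e :: "'a::cancel_semigroup_add"
  assumes "finite A" "finite B" "\<And>v. v \<in> A \<Longrightarrow> v + e \<in> B"
  shows "(\<Sum>v\<in>A. of_bool (v + e \<in> \<T>)) \<le> real (card (\<T> \<inter> B))"
proof -
  have "(\<Sum>v\<in>A. of_bool (v + e \<in> \<T>)) = real (card {v\<in>A. v + e \<in> \<T>})"
    using assms by (simp add: Int_def)
  also have "card {v\<in>A. v + e \<in> \<T>} \<le> card (\<T> \<inter> B)"
    using assms by (intro card_inj_on_le[where f = "\<lambda>v. v + e"]) (auto simp: inj_on_def)
  finally show ?thesis
    by simp
qed

lemma card_broadcast_box_ge:
  assumes "broadcast 2 2 \<T>"
  shows "real (card (\<T> \<inter> grid_box (Suc n))) \<ge> real (card (grid_box n)) / 3"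
proof -
  let ?k = "real (card (\<T> \<inter> grid_box (Suc n)))"
  have le: "(\<Sum>v\<in>grid_box n. of_bool (v + e \<in> \<T>)) \<le> ?k" if "e \<in> insert 0 units" for e
    by (rule sum_translate_le_card)
      (use that in \<open>auto simp: finite_grid_box grid_box_def units_def zero_prod_def\<close>)
  have "2 * real (card (grid_box n)) \<le> (\<Sum>v\<in>grid_box n. signal 2 2 \<T> v)"
    using assms sum_bounded_below[of "grid_box n" 2 "signal 2 2 \<T>"]
    by (auto simp: broadcast_def mult.commute)
  also have "\<dots> = 2 * (\<Sum>v\<in>grid_box n. of_bool (v + 0 \<in> \<T>)) +
      (\<Sum>e\<in>units. \<Sum>v\<in>grid_box n. of_bool (v + e \<in> \<T>))"
    unfolding signal_2_2 sum.distrib sum_distrib_left by (subst (2) sum.swap) simp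
  also have "\<dots> \<le> 2 * ?k + (\<Sum>e\<in>units. ?k)"
    by (intro add_mono sum_mono mult_left_mono le) simp_all
  also have "\<dots> = 6 * ?k"
    by (simp add: units_def)
  finally show ?thesis
    by simp
qed

lemma card_grid_box_ratio_tendsto:
  "(\<lambda>n. real (card (grid_box n)) / real (card (grid_box (Suc n)))) \<longlonglongrightarrow> 1"
proof -
  have "(\<lambda>n. ((2 * real n + 1) / (2 * real n + 3))\<^sup>2) \<longlonglongrightarrow> 1"
    by real_asymp
  then show ?thesis
    by (simp add: card_grid_box power_divide algebra_simps)
qed

lemma broadcast_density_ge:
  assumes "broadcast 2 2 \<T>" "has_broadcast_density \<T> d"
  shows "1 / 3 \<le> d"
proof (rule LIMSEQ_le)
  show "(\<lambda>n. 1 / 3 * (real (card (grid_box n)) / real (card (grid_box (Suc n))))) \<longlonglongrightarrow> 1 / 3"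
    using tendsto_mult_left[OF card_grid_box_ratio_tendsto, of "1 / 3"] by simp
  show "(\<lambda>n. real (card (\<T> \<inter> grid_box (Suc n))) / real (card (grid_box (Suc n)))) \<longlonglongrightarrow> d"
    using assms(2) unfolding has_broadcast_density_def by (rule LIMSEQ_Suc)
  show "\<exists>N. \<forall>n\<ge>N. 1 / 3 * (real (card (grid_box n)) / real (card (grid_box (Suc n))))
      \<le> real (card (\<T> \<inter> grid_box (Suc n))) / real (card (grid_box (Suc n)))"
    using divide_right_mono[OF card_broadcast_box_ge[OF assms(1)]] by simp
qed

text \<open>The union of every third antidiagonal of the grid.\<close>

definition diagonals :: "int \<Rightarrow> vertex set" where
  "diagonals i = {(a, b). (a + b) mod 3 = i}"

lemma broadcast_diagonals:
  assumes "i \<in> {0, 1, 2}"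
  shows "broadcast 2 2 (diagonals i)"
  unfolding broadcast_def
proof
  fix v :: vertex
  obtain a b where v: "v = (a, b)"
    by fastforce
  \<comment> \<open>The neighbours of \<open>v\<close> have coordinate sums \<open>a + b + 1\<close> and \<open>a + b - 1\<close>, each occurring twice.\<close>
  have "(\<Sum>e\<in>units. of_bool (v + e \<in> diagonals i)) =
      2 * of_bool ((a + b + 1) mod 3 = i) + (2 * of_bool ((a + b - 1) mod 3 = i) :: real)"
    by (simp add: units_def diagonals_def v algebra_simps)
  moreover have "(a + b) mod 3 = i \<or> (a + b + 1) mod 3 = i \<or> (a + b - 1) mod 3 = i"
    using assms by (elim insertE emptyE; simp; presburger)
  ultimately show "real 2 \<le> signal 2 2 (diagonals i) v"
    by (auto simp: signal_2_2 diagonals_def v)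
qed

lemma card_grid_box_diagonals:
  "card (grid_box n) = card (diagonals 0 \<inter> grid_box n) + card (diagonals 1 \<inter> grid_box n)
    + card (diagonals 2 \<inter> grid_box n)"
proof -
  have "(a + b) mod 3 = 0 \<or> (a + b) mod 3 = 1 \<or> (a + b) mod 3 = 2" for a b :: int
    by presburger
  then have "grid_box n = (diagonals 0 \<inter> grid_box n \<union> diagonals 1 \<inter> grid_box n)
      \<union> diagonals 2 \<inter> grid_box n"
    by (auto simp: diagonals_def)
  also have "card \<dots> = card (diagonals 0 \<inter> grid_box n \<union> diagonals 1 \<inter> grid_box n)
      + card (diagonals 2 \<inter> grid_box n)"
    by (rule card_Un_disjoint) (auto simp: finite_grid_box diagonals_def)
  also have "card (diagonals 0 \<inter> grid_box n \<union> diagonals 1 \<inter> grid_box n) =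
      card (diagonals 0 \<inter> grid_box n) + card (diagonals 1 \<inter> grid_box n)"
    by (rule card_Un_disjoint) (auto simp: finite_grid_box diagonals_def)
  finally show ?thesis .
qed

lemma has_broadcast_density_diagonals: "has_broadcast_density (diagonals 0) (1 / 3)"
proof -
  let ?V = "\<lambda>n. real (card (grid_box n))"
  let ?D = "\<lambda>i n. real (card (diagonals i \<inter> grid_box n))"
  have pos: "?V n > 0" for n
    by (simp add: card_grid_box)
  have ge: "?V n / 3 \<le> ?D i (Suc n)" if "i \<in> {0, 1, 2}" for i n
    using card_broadcast_box_ge[OF broadcast_diagonals[OF that]] by simp
  have lower: "1 / 3 * (?V n / ?V (Suc n)) \<le> ?D 0 (Suc n) / ?V (Suc n)" for n
    using divide_right_mono[OF ge[of 0 n], of "?V (Suc n)"] by simp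
  have upper: "?D 0 (Suc n) / ?V (Suc n) \<le> 1 - 2 / 3 * (?V n / ?V (Suc n))" for n
  proof -
    have "?D 0 (Suc n) \<le> ?V (Suc n) - 2 / 3 * ?V n"
      using ge[of 1 n] ge[of 2 n] card_grid_box_diagonals[of "Suc n"] by simp
    then show ?thesis
      using pos[of "Suc n"] by (simp add: field_simps)
  qed
  have "(\<lambda>n. ?D 0 (Suc n) / ?V (Suc n)) \<longlonglongrightarrow> 1 / 3"
  proof (rule tendsto_sandwich)
    show "(\<lambda>n. 1 / 3 * (?V n / ?V (Suc n))) \<longlonglongrightarrow> 1 / 3"
      using tendsto_mult_left[OF card_grid_box_ratio_tendsto, of "1 / 3"] by simp
    show "(\<lambda>n. 1 - 2 / 3 * (?V n / ?V (Suc n))) \<longlonglongrightarrow> 1 / 3"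
      using tendsto_diff[OF tendsto_const tendsto_mult_left[OF card_grid_box_ratio_tendsto],
        of 1 "2 / 3"] by simp
  qed (use lower upper in auto)
  then show ?thesis
    unfolding has_broadcast_density_def by (rule LIMSEQ_imp_Suc)
qed

theorem proposition1: "is_optimal_density 2 2 (1/3)"
  unfolding is_optimal_density_def
  using broadcast_diagonals[of 0] has_broadcast_density_diagonals broadcast_density_ge by blast

end
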